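(* Let $\phi=\frac{1+\sqrt5}{2}$. Let $(a,b,c)$, with $a,b,c$ nonnegative integers, be a non-palindrome $P$ position in Twyst-off (i.e. a $P$ position with $a\neq c$). Then either $a=0$, or $$\left\lfloor \frac{a}{\phi}\right\rfloor \le b\le \lceil \phi^2 a\rceil .$$ Moreover both inequalities are sharp for infinitely many positions: for each of the two inequalities there are infinitely many non-palindrome $P$ positions $(a,b,c)$ with $a>0$ for which equality holds.
   Context: Twyst-off is a two-player impartial game (players alternate; normal play: the last player to move legally wins). A position is a finite ordered sequence $(s_1,\dots,s_n)$ of stacks of tiles, with stack sizes nonnegative integers. Positions are subject to the identifications: an end stack of size $0$ is deleted; an interior stack of size $0$ is deleted and its two neighbors are combined, i.e. $(\dots,x,0,y,\dots)=(\dots,x+y,\dots)$. Thus every position equals a (possibly empty) sequence of positive integers. From a sequence of positive integers, a move is one of: (i) remove $k\ge 1$ tiles from the first or from the last stack; (ii) remove the same number $k\ge 1$ of tiles from two consecutive stacks; after which the identifications are applied. A position is $P$ if the previous (second) player can force a win, equivalently if none of its options (positions reachable in one move) is $P$; it is $N$ if the next (first) player can force a win, equivalently if some option is $P$. A three-stack position $(a,b,c)$ is a palindrome if $a=c$. *)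

theory Defs
  imports Complex_Main
begin

text \<open>
  A position of Twyst-off is a finite sequence of stack sizes, taken modulo the identifications
  that delete an end stack of size 0 and replace \<open>\<dots>, x, 0, y, \<dots>\<close> by \<open>\<dots>, x + y, \<dots>\<close>.
  Every sequence is identified with exactly one sequence of positive integers; \<open>settle\<close> computes
  it. The lemmas below show that \<open>settle\<close> respects the identifications, yields
  positive sequences, and fixes those.
\<close>

fun settle :: "nat list \<Rightarrow> nat list" where
  "settle [] = []"
| "settle (0 # xs) = settle xs"
| "settle [Suc x] = [Suc x]"
| "settle [Suc x, 0] = [Suc x]"
| "settle (Suc x # 0 # y # ys) = settle ((Suc x + y) # ys)"
| "settle (Suc x # Suc y # ys) = Suc x # settle (Suc y # ys)"

lemma settle_first_zero: "settle (0 # xs) = settle xs"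
  by simp

lemma settle_last_zero: "settle (xs @ [0]) = settle xs"
  by (induction xs rule: settle.induct) simp_all

lemma settle_interior_zero: "settle (xs @ x # 0 # y # ys) = settle (xs @ (x + y) # ys)"
proof (induction xs rule: settle.induct)
  case 1
  then show ?case by (cases x) simp_all
next
  case (3 z)
  then show ?case by (cases x; cases y; cases ys) (simp_all add: add.assoc)
next
  case (4 z)
  then show ?case by (cases x) (simp_all add: add.assoc)
qed simp_all

lemma settle_positive: "0 \<notin> set (settle xs)"
  by (induction xs rule: settle.induct) simp_all

lemma settle_id: "0 \<notin> set xs \<Longrightarrow> settle xs = xs"
  by (induction xs rule: settle.induct) simp_all

lemma sum_list_settle: "sum_list (settle xs) = sum_list xs"
  by (induction xs rule: settle.induct) simp_all

inductive move :: "nat list \<Rightarrow> nat list \<Rightarrow> bool" where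
  first_stack: "\<lbrakk>0 \<notin> set (x # xs); 1 \<le> k; k \<le> x\<rbrakk>
    \<Longrightarrow> move (x # xs) (settle ((x - k) # xs))"
| last_stack: "\<lbrakk>0 \<notin> set (xs @ [x]); 1 \<le> k; k \<le> x\<rbrakk>
    \<Longrightarrow> move (xs @ [x]) (settle (xs @ [x - k]))"
| two_stacks: "\<lbrakk>0 \<notin> set (xs @ x # y # ys); 1 \<le> k; k \<le> x; k \<le> y\<rbrakk>
    \<Longrightarrow> move (xs @ x # y # ys) (settle (xs @ (x - k) # (y - k) # ys))"

lemma move_sum_list_less: "move xs ys \<Longrightarrow> sum_list ys < sum_list xs"
  by (induction rule: move.induct) (simp_all add: sum_list_settle)

text \<open>
  Moves start from sequences of positive integers only, so the recursion is meaningful for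
  such sequences; an arbitrary sequence is a P position when its settled form is one.
\<close>

function settled_P :: "nat list \<Rightarrow> bool" where
  "settled_P xs \<longleftrightarrow> (\<forall>ys. move xs ys \<longrightarrow> \<not> settled_P ys)"
  by auto
termination
  by (relation "measure sum_list") (simp_all add: move_sum_list_less)

declare settled_P.simps [simp del]

definition P_position :: "nat list \<Rightarrow> bool" where
  "P_position xs \<longleftrightarrow> settled_P (settle xs)"

definition phi :: real where
  "phi = (1 + sqrt 5) / 2"

end

theory Submission
  imports Defs
begin

text \<open>
  Fix \<open>b - a\<close> and call a P position \<open>(a, b, c)\<close> with \<open>a < c\<close> lower and one with \<open>c < a\<close> upper at
  \<open>(a, b)\<close>. The position \<open>(a, b, a)\<close> is then an N position, and chasing the P option that
  witnesses this shows that the non-palindromes on each diagonal form chains: the larger end of a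
  lower position is the first stack of the next lower position, and likewise for the upper
  positions once the triangle inequality \<open>\<bar>a - c\<bar> < b\<close> is known
  for \<open>a, c > 0\<close>. Every chain starts at a position
  whose first or last stack is empty, that is, at a P position of Wythoff's game. The slope of a
  diagonal point only moves towards 1 along a chain, so the Wythoff pairs give both bounds.

  For the triangle inequality take a counterexample \<open>(c, b, a)\<close> with \<open>a \<ge> c + b\<close> and \<open>b\<close>, then
  \<open>c\<close>, minimal. The sum \<open>c + y - h\<close> is unchanged by removing tiles from the last two stacks of
  \<open>(c, y, h)\<close>, so the P positions \<open>(c, y, h)\<close> with \<open>y < b\<close> have distinct values of it. One of
  them takes the value \<open>b\<close>, hence some value \<open>d < b\<close> is missing, and then
  \<open>(c, b, c + b - d)\<close> has no P option by the chain structure, although \<open>(c, b, a)\<close> moves to it.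
\<close>

section \<open>Recursion for positions with at most three stacks\<close>

abbreviation P2 :: "nat \<Rightarrow> nat \<Rightarrow> bool" where
  "P2 a b \<equiv> P_position [a, b]"

abbreviation P3 :: "nat \<Rightarrow> nat \<Rightarrow> nat \<Rightarrow> bool" where
  "P3 a b c \<equiv> P_position [a, b, c]"

lemma P_position_iff:
  assumes "0 \<notin> set xs"
  shows "P_position xs \<longleftrightarrow> (\<forall>ys. move xs ys \<longrightarrow> \<not> settled_P ys)"
  using assms by (simp add: P_position_def settle_id settled_P.simps[of xs])

section \<open>Explicit move lists and the resulting P recursion\<close>

lemma move_single: "move [a] ys \<longleftrightarrow> (\<exists>k. 1 \<le> k \<and> k \<le> a \<and> ys = settle [a - k])"
  by (subst move.simps) (auto simp: Cons_eq_append_conv)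

lemma move_pair:
  assumes "a > 0" "b > 0"
  shows "move [a, b] ys \<longleftrightarrow>
    (\<exists>k. 1 \<le> k \<and> k \<le> a \<and> ys = settle [a - k, b]) \<or>
    (\<exists>k. 1 \<le> k \<and> k \<le> b \<and> ys = settle [a, b - k]) \<or>
    (\<exists>k. 1 \<le> k \<and> k \<le> a \<and> k \<le> b \<and> ys = settle [a - k, b - k])"
  using assms by (subst move.simps) (auto simp: Cons_eq_append_conv)

lemma move_triple:
  assumes "a > 0" "b > 0" "c > 0"
  shows "move [a, b, c] ys \<longleftrightarrow>
    (\<exists>k. 1 \<le> k \<and> k \<le> a \<and> ys = settle [a - k, b, c]) \<or>
    (\<exists>k. 1 \<le> k \<and> k \<le> c \<and> ys = settle [a, b, c - k]) \<or>
    (\<exists>k. 1 \<le> k \<and> k \<le> a \<and> k \<le> b \<and> ys = settle [a - k, b - k, c]) \<or>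
    (\<exists>k. 1 \<le> k \<and> k \<le> b \<and> k \<le> c \<and> ys = settle [a, b - k, c - k])"
    (is "_ \<longleftrightarrow> ?R")
proof
  assume "move [a, b, c] ys"
  then show ?R
    by cases (auto simp: Cons_eq_append_conv)
next
  assume ?R
  then show "move [a, b, c] ys"
    using assms move.first_stack[of a "[b, c]"] move.last_stack[of "[a, b]" c]
      move.two_stacks[of "[]" a b "[c]"] move.two_stacks[of "[a]" b c "[]"]
    by (auto simp del: settle.simps)
qed

lemma P_position_Nil: "P_position []"
proof -
  have "\<not> move [] ys" for ys
    by (subst move.simps) auto
  then show ?thesis by (simp add: P_position_iff)
qed

lemma P_position_single: "P_position [a] \<longleftrightarrow> a = 0"
proof (cases "a = 0")
  case True
  then show ?thesis using P_position_Nil by (simp add: P_position_def)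
next
  case False
  have "move [a] []"
    unfolding move_single using False by (intro exI[of _ a]) simp
  moreover have "settled_P []"
    using P_position_Nil by (simp add: P_position_def)
  ultimately show ?thesis using False by (auto simp: P_position_iff)
qed

lemma P2_zero_left: "P2 0 b \<longleftrightarrow> b = 0"
  using P_position_single[of b] by (simp add: P_position_def)

lemma P2_zero_right: "P2 a 0 \<longleftrightarrow> a = 0"
  using P_position_single[of a] settle_last_zero[of "[a]"] by (simp add: P_position_def)

lemma P2_iff:
  assumes "a > 0" "b > 0"
  shows "P2 a b \<longleftrightarrow>
    (\<forall>k. 1 \<le> k \<and> k \<le> a \<longrightarrow> \<not> P2 (a - k) b) \<and>
    (\<forall>k. 1 \<le> k \<and> k \<le> b \<longrightarrow> \<not> P2 a (b - k)) \<and>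
    (\<forall>k. 1 \<le> k \<and> k \<le> a \<and> k \<le> b \<longrightarrow> \<not> P2 (a - k) (b - k))"
proof -
  have "P2 a b \<longleftrightarrow> (\<forall>ys. move [a, b] ys \<longrightarrow> \<not> settled_P ys)"
    using assms by (intro P_position_iff) auto
  then show ?thesis
    unfolding move_pair[OF assms] P_position_def by blast
qed

lemma P3_zero_left: "P3 0 b c \<longleftrightarrow> P2 b c"
  by (simp add: P_position_def)

lemma P3_zero_right: "P3 a b 0 \<longleftrightarrow> P2 a b"
  using settle_last_zero[of "[a, b]"] by (simp add: P_position_def)

lemma P3_zero_middle: "P3 a 0 c \<longleftrightarrow> a = 0 \<and> c = 0"
  using settle_interior_zero[of "[]" a c "[]"] P_position_single[of "a + c"]
  by (simp add: P_position_def)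

lemma P3_iff:
  assumes "a > 0" "b > 0" "c > 0"
  shows "P3 a b c \<longleftrightarrow>
    (\<forall>k. 1 \<le> k \<and> k \<le> a \<longrightarrow> \<not> P3 (a - k) b c) \<and>
    (\<forall>k. 1 \<le> k \<and> k \<le> c \<longrightarrow> \<not> P3 a b (c - k)) \<and>
    (\<forall>k. 1 \<le> k \<and> k \<le> a \<and> k \<le> b \<longrightarrow> \<not> P3 (a - k) (b - k) c) \<and>
    (\<forall>k. 1 \<le> k \<and> k \<le> b \<and> k \<le> c \<longrightarrow> \<not> P3 a (b - k) (c - k))"
proof -
  have "P3 a b c \<longleftrightarrow> (\<forall>ys. move [a, b, c] ys \<longrightarrow> \<not> settled_P ys)"
    using assms by (intro P_position_iff) auto
  then show ?thesis
    unfolding move_triple[OF assms] P_position_def by blast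
qed

section \<open>Mirror symmetry of P positions\<close>

lemma P2_sym: "P2 a b \<longleftrightarrow> P2 b a"
proof (induction "a + b" arbitrary: a b rule: less_induct)
  case less
  show ?case
  proof (cases "a = 0 \<or> b = 0")
    case True
    then show ?thesis by (auto simp: P2_zero_left P2_zero_right)
  next
    case False
    then have "a > 0" "b > 0" by auto
    have "P2 (a - k) b \<longleftrightarrow> P2 b (a - k)" if "1 \<le> k \<and> k \<le> a" for k
      using that by (intro less) auto
    moreover have "P2 a (b - k) \<longleftrightarrow> P2 (b - k) a" if "1 \<le> k \<and> k \<le> b" for k
      using that by (intro less) auto
    moreover have "P2 (a - k) (b - k) \<longleftrightarrow> P2 (b - k) (a - k)"
      if "1 \<le> k \<and> k \<le> a \<and> k \<le> b" for k
      using that by (intro less) auto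
    ultimately show ?thesis
      unfolding P2_iff[OF \<open>a > 0\<close> \<open>b > 0\<close>] P2_iff[OF \<open>b > 0\<close> \<open>a > 0\<close>] by blast
  qed
qed

lemma P3_sym: "P3 a b c \<longleftrightarrow> P3 c b a"
proof (induction "a + b + c" arbitrary: a b c rule: less_induct)
  case less
  show ?case
  proof (cases "a = 0 \<or> b = 0 \<or> c = 0")
    case True
    then show ?thesis
      using P2_sym by (auto simp: P3_zero_left P3_zero_right P3_zero_middle P2_zero_left)
  next
    case False
    then have pos: "a > 0" "b > 0" "c > 0" by auto
    have "P3 (a - k) b c \<longleftrightarrow> P3 c b (a - k)" if "1 \<le> k \<and> k \<le> a" for k
      using that by (intro less) auto
    moreover have "P3 a b (c - k) \<longleftrightarrow> P3 (c - k) b a" if "1 \<le> k \<and> k \<le> c" for k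
      using that by (intro less) auto
    moreover have "P3 (a - k) (b - k) c \<longleftrightarrow> P3 c (b - k) (a - k)"
      if "1 \<le> k \<and> k \<le> a \<and> k \<le> b" for k
      using that by (intro less) auto
    moreover have "P3 a (b - k) (c - k) \<longleftrightarrow> P3 (c - k) (b - k) a"
      if "1 \<le> k \<and> k \<le> b \<and> k \<le> c" for k
      using that by (intro less) auto
    ultimately show ?thesis
      unfolding P3_iff[OF pos] P3_iff[OF pos(3,2,1)] by (smt (verit, del_insts))
  qed
qed

lemma P3_not_less: "P3 a b c \<Longrightarrow> c < c' \<Longrightarrow> \<not> P3 a b c'"
proof
  assume *: "P3 a b c" "c < c'" "P3 a b c'"
  define k where "k = c' - c"
  have k: "1 \<le> k" "k \<le> c'" "c' - k = c" using * by (auto simp: k_def)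
  show False
  proof (cases "a = 0 \<or> b = 0")
    case True
    then show ?thesis
      using * k P2_iff[of b c'] by (cases "b = 0") (auto simp: P3_zero_left P3_zero_middle P2_zero_left)
  next
    case False
    then show ?thesis using * k P3_iff[of a b c'] by auto
  qed
qed

lemma P3_unique: "P3 a b c \<Longrightarrow> P3 a b c' \<Longrightarrow> c = c'"
  using P3_not_less by (metis linorder_neqE_nat)

lemma P3_not_diagonal: "P3 a b c \<Longrightarrow> m > 0 \<Longrightarrow> \<not> P3 a (b + m) (c + m)"
proof
  assume *: "P3 a b c" "m > 0" "P3 a (b + m) (c + m)"
  show False
  proof (cases "a = 0")
    case True
    then have "P2 b c" "P2 (b + m) (c + m)" using * by (auto simp: P3_zero_left)
    then show ?thesis using *(2) P2_iff[of "b + m" "c + m"] by (auto dest!: spec[of _ m])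
  next
    case False
    then show ?thesis using * P3_iff[of a "b + m" "c + m"] by (auto dest!: spec[of _ m])
  qed
qed

text \<open>Taking the whole middle stack merges the outer ones into a single nonempty stack, an N
  position; hence \<open>i < b\<close> in both pair cases.\<close>

lemma P3_option_cases:
  assumes "\<not> P3 a b c" "a > 0" "b > 0" "c > 0"
  obtains (left) i where "1 \<le> i" "i \<le> a" "P3 (a - i) b c"
    | (right) i where "1 \<le> i" "i \<le> c" "P3 a b (c - i)"
    | (left_pair) i where "1 \<le> i" "i \<le> a" "i < b" "P3 (a - i) (b - i) c"
    | (right_pair) i where "1 \<le> i" "i \<le> c" "i < b" "P3 a (b - i) (c - i)"
proof -
  have "i < b" if "i \<le> b" "P3 (a - i) (b - i) c \<or> P3 a (b - i) (c - i)" for i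
    using that assms(2,4) by (cases "i = b") (auto simp: P3_zero_middle)
  then show ?thesis
    using assms P3_iff[OF assms(2-4)] that by blast
qed

section \<open>Chains of non-palindromes on diagonals\<close>

text \<open>\<open>(a, b, a)\<close> is an option of \<open>(a, b, c)\<close>, hence N. A P option
  by an end move would be \<open>(a, b, a - i)\<close> up to reversal, again an option of
  \<open>(a, b, c)\<close>; so a pair move remains.\<close>

lemma lower_predecessor:
  assumes "P3 a b c" "0 < a" "a < c" "0 < b"
  obtains k where "1 \<le> k" "k \<le> a" "k < b" "P3 (a - k) (b - k) a"
proof -
  have no: "\<not> P3 a b i" if "i < c" for i
    using P3_not_less[of a b i c] assms(1) that by blast
  from no[OF assms(3)] assms(2,4,2) show ?thesis
  proof (cases rule: P3_option_cases)
    case (left i)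
    then show ?thesis using no[of "a - i"] assms(3) P3_sym by auto
  next
    case (right i)
    then show ?thesis using no[of "a - i"] assms(3) by auto
  next
    case (left_pair i)
    then show ?thesis using that by blast
  next
    case (right_pair i)
    then show ?thesis using that P3_sym by blast
  qed
qed

text \<open>Compare \<open>(l, m, u)\<close> with the predecessor \<open>(l2, m2, l')\<close>. If
  \<open>l2 = l\<close>, uniqueness gives \<open>u = l'\<close>. Otherwise induction gives
  \<open>u \<le> l2\<close> or, with the roles exchanged, the absurd
  \<open>l' \<le> l\<close>.\<close>

lemma lower_chain:
  assumes "P3 l m u" "P3 l' m' u'" "l < l'" "l' < u'" "m + l' = m' + l"
  shows "u \<le> l'"
  using assms
proof (induction l' arbitrary: l m u m' u' rule: less_induct)
  case (less l')
  have "0 < m'" using less.prems by (cases "m' = 0") (auto simp: P3_zero_middle)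
  then obtain k where k: "1 \<le> k" "k \<le> l'" "k < m'" "P3 (l' - k) (m' - k) l'"
    using lower_predecessor[OF less.prems(2)] less.prems by auto
  define l2 where "l2 = l' - k"
  define m2 where "m2 = m' - k"
  have l2: "l2 < l'" "P3 l2 m2 l'" "m2 + l' = m' + l2"
    using k by (auto simp: l2_def m2_def)
  consider "l2 = l" | "l < l2" | "l2 < l" by linarith
  then show ?case
  proof cases
    case 1
    then have "m2 = m" using l2 less.prems(5) by linarith
    then show ?thesis using P3_unique 1 l2(2) less.prems(1) by blast
  next
    case 2
    then show ?thesis using less.IH[OF l2(1) less.prems(1) l2(2)] l2 less.prems(5) by auto
  next
    case 3
    show ?thesis
    proof (cases "l < u")
      case True
      then show ?thesis
        using less.IH[OF less.prems(3) l2(2) less.prems(1) 3] l2 less.prems by auto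
    qed (use less.prems in auto)
  qed
qed

text \<open>For \<open>t = a + b - c\<close> the palindrome \<open>(a, t, a)\<close> is an option of
  \<open>(a, b, c)\<close>, hence N. Its pair options are, up to reversal, options of
  \<open>(a, b, c)\<close> too, so its P option comes from an end move. The triangle inequality
  \<open>c < a + b\<close> keeps \<open>t\<close> positive.\<close>

lemma upper_predecessor:
  assumes "P3 a b c" "0 < a" "a < c" "c < a + b"
  obtains a' where "a' < a" "P3 a' (a + b - c) a"
proof -
  define t where "t = a + b - c"
  define m where "m = c - a"
  have t: "0 < t" "m > 0" "b = t + m" "c = a + m" using assms by (auto simp: t_def m_def)
  have "\<not> P3 a t a" using P3_not_diagonal[of a t a m] assms t by auto
  then show ?thesis using assms(2) t(1) assms(2)
  proof (cases rule: P3_option_cases)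
    case (left i)
    then show ?thesis using that[of "a - i"] by (auto simp: t_def)
  next
    case (right i)
    then show ?thesis using that[of "a - i"] P3_sym by (auto simp: t_def)
  next
    case (left_pair i)
    then have "P3 a (t - i) (a - i)" using P3_sym by blast
    then show ?thesis using P3_not_diagonal[of a "t - i" "a - i" "m + i"] assms(1) t left_pair
      by (auto simp: algebra_simps)
  next
    case (right_pair i)
    then show ?thesis using P3_not_diagonal[of a "t - i" "a - i" "m + i"] assms(1) t
      by (auto simp: algebra_simps)
  qed
qed

text \<open>Upper positions are written with the larger end last. If \<open>a\<close> and
  \<open>a'\<close> differ, the position with the larger of them is replaced by its predecessor,
  which lowers \<open>c + x\<close>; if they agree, a pair move joins two P positions.
  \<open>tri\<close> is restricted to middle stacks below \<open>e\<close> so that it can be an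
  induction hypothesis for the triangle inequality itself.\<close>

lemma upper_chain:
  assumes tri: "\<And>z y w. y < e \<Longrightarrow> 0 < z \<Longrightarrow> 0 < y \<Longrightarrow> P3 z y w \<Longrightarrow> w < z + y"
    and "P3 a t c" "a < c" "0 < t" "P3 a' e x" "a' < x" "a' = 0 \<or> x < a' + e"
    and "c < x" "e + c = t + x"
  shows "c \<le> a'"
  using assms
proof (induction "c + x" arbitrary: a t c a' e x rule: less_induct)
  case less
  show ?case
  proof (rule ccontr)
    assume "\<not> c \<le> a'"
    then have c: "a' < c" by simp
    have te: "t < e" using less.prems by linarith
    consider "a = a'" | "a' < a" | "a < a'" by linarith
    then show False
    proof cases
      case 1
      have "e = t + (x - c)" "x = c + (x - c)" using less.prems by auto
      then show ?thesis using P3_not_diagonal[of a t c "x - c"] 1 less.prems by auto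
    next
      case 2
      have "c < a + t" using less.prems 2 te by auto
      then obtain a2 where a2: "a2 < a" "P3 a2 (a + t - c) a"
        using upper_predecessor[of a t c] less.prems 2 by auto
      have "a \<le> a'"
      proof (rule less.hyps[of a x e a2 "a + t - c"])
        show "a + x < c + x" using less.prems by simp
      qed (use less.prems a2 \<open>c < a + t\<close> in auto)
      then show ?thesis using 2 by simp
    next
      case 3
      have xe: "x < a' + e" using less.prems 3 by auto
      then obtain a2 where a2: "a2 < a'" "P3 a2 (a' + e - x) a'"
        using upper_predecessor[of a' e x] less.prems 3 by auto
      have "a' \<le> a"
      proof (rule less.hyps[of a' c t a2 "a' + e - x"])
        show "a' + c < c + x" using less.prems by simp
        show "a = 0 \<or> c < a + t" using less.prems(1)[of t a c] less.prems(2,4) te by auto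
      qed (use less.prems a2 xe c te in auto)
      then show ?thesis using 3 by simp
    qed
  qed
qed

section \<open>The triangle inequality for P positions\<close>

lemma P3_triangle:
  assumes "P3 c b a" "0 < c" "0 < b"
  shows "a < c + b"
  using assms
proof (induction b arbitrary: c a rule: less_induct)
  case (less b)
  \<comment> \<open>The outer hypothesis feeds \<open>upper_chain\<close>; the inner induction on
    \<open>c\<close> supplies its side condition for middle stack \<open>b\<close>.\<close>
  note tri = less.IH
  from less.prems show ?case
  proof (induction c arbitrary: a rule: less_induct)
    case (less c)
    show ?case
    proof (rule ccontr)
      assume "\<not> a < c + b"
      then have a: "c + b \<le> a" by simp
      have no: "\<not> P3 c b i" if "i < a" for i
        using P3_not_less[of c b i a] less.prems(1) that by blast
      \<comment> \<open>\<open>level d y\<close> says \<open>P3 c y (c + y - d)\<close>, written without truncated subtraction.\<close>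
      define level where "level d y \<longleftrightarrow> (\<exists>h. P3 c y h \<and> c + y = d + h)" for d y
      \<comment> \<open>Reversed, this predecessor has level \<open>b\<close>, so the missing level
        \<open>d\<close> found below cannot be \<open>b\<close>.\<close>
      obtain k where k: "1 \<le> k" "k \<le> c" "k < b" "P3 (c - k) (b - k) c"
        using lower_predecessor[OF less.prems(1)] less.prems a by auto
      then have b_level: "level b (b - k)"
        unfolding level_def by (intro exI[of _ "c - k"]) (auto simp: P3_sym)
      \<comment> \<open>Pigeonhole: each \<open>y\<close> has at most one level because the third
        stack is unique, so \<open>b - 1\<close> middle stacks cannot realise \<open>b\<close>
        levels.\<close>
      have "\<exists>d\<in>{1..b}. \<forall>y\<in>{1..<b}. \<not> level d y"
      proof (rule ccontr)
        assume "\<not> ?thesis"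
        then have "\<forall>d\<in>{1..b}. \<exists>y. y \<in> {1..<b} \<and> level d y" by blast
        then obtain f where f: "\<forall>d\<in>{1..b}. f d \<in> {1..<b} \<and> level d (f d)"
          by (metis (no_types, lifting))
        have "inj_on f {1..b}"
        proof (rule inj_onI)
          fix d d' assume "d \<in> {1..b}" "d' \<in> {1..b}" "f d = f d'"
          then have "level d (f d)" "level d' (f d)" using f by metis+
          then show "d = d'" unfolding level_def using P3_unique by (metis add_right_cancel)
        qed
        then have "card {1..b} \<le> card {1..<b}" by (rule card_inj_on_le) (use f in auto)
        then show False using less.prems by simp
      qed
      then obtain d where d: "1 \<le> d" "d \<le> b" "\<And>y. 0 < y \<Longrightarrow> y < b \<Longrightarrow> \<not> level d y"
        by (metis One_nat_def Suc_leI atLeastAtMost_iff atLeastLessThan_iff)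
      have "d \<noteq> b" using d(3)[of "b - k"] b_level k by auto
      then have db: "d < b" using d by simp
      \<comment> \<open>As a P position \<open>(c, d, c)\<close> would have level \<open>d\<close>.
        Its pair options keep that level, so its P option comes from an end move.\<close>
      have "\<not> P3 c d c" using d(3)[of d] db d(1) unfolding level_def by auto
      moreover have "0 < d" using d by simp
      ultimately have "\<exists>a1<c. P3 a1 d c"
      proof (rule P3_option_cases[OF _ less.prems(2) _ less.prems(2)])
        fix i assume "1 \<le> i" "i \<le> c" "P3 (c - i) d c"
        then show ?thesis using less.prems by (intro exI[of _ "c - i"]) auto
      next
        fix i assume "1 \<le> i" "i \<le> c" "P3 c d (c - i)"
        then show ?thesis using less.prems P3_sym by (intro exI[of _ "c - i"]) auto
      next
        fix i assume i: "1 \<le> i" "i \<le> c" "i < d" "P3 (c - i) (d - i) c"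
        then have "level d (d - i)"
          unfolding level_def by (intro exI[of _ "c - i"]) (auto simp: P3_sym)
        then show ?thesis using d(3)[of "d - i"] i db by auto
      next
        fix i assume i: "1 \<le> i" "i \<le> c" "i < d" "P3 c (d - i) (c - i)"
        then have "level d (d - i)"
          unfolding level_def by (intro exI[of _ "c - i"]) auto
        then show ?thesis using d(3)[of "d - i"] i db by auto
      qed
      then obtain a1 where a1: "a1 < c" "P3 a1 d c" by blast
      \<comment> \<open>Chosen so that \<open>(c, b, x)\<close> would have the missing level
        \<open>d\<close>, while \<open>c < x < a\<close>.\<close>
      define x where "x = c + b - d"
      have x: "c < x" "x < a" "d + x = b + c" using db d(1) a by (auto simp: x_def)
      have "\<not> P3 c b x" "0 < c" "0 < b" "0 < x" using no x less.prems by auto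
      \<comment> \<open>An option \<open>left\<close> contradicts \<open>upper_chain\<close> against
        \<open>(a1, d, c)\<close>, and \<open>left_pair\<close> contradicts
        \<open>lower_chain\<close> against \<open>(c, b, a)\<close>; \<open>right\<close>
        contradicts \<open>no\<close>, and \<open>right_pair\<close> would have level
        \<open>d\<close>.\<close>
      then show False
      proof (cases rule: P3_option_cases)
        case (left i)
        have "c \<le> c - i"
        proof (rule upper_chain[of b a1 d c "c - i" x])
          show "c - i = 0 \<or> x < c - i + b"
            using less.IH[of "c - i" x] left less.prems by (cases "i = c") auto
        qed (use tri a1 left x d in auto)
        then show ?thesis using left less.prems by auto
      next
        case (right i)
        then show ?thesis using no[of "x - i"] x by auto
      next
        case (left_pair i)
        then show ?thesis
          using lower_chain[of "c - i" "b - i" x c b a] less.prems x a by auto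
      next
        case (right_pair i)
        then have "level d (b - i)"
          unfolding level_def using x by (intro exI[of _ "x - i"]) auto
        then show ?thesis using d(3)[of "b - i"] right_pair by auto
      qed
    qed
  qed
qed

text \<open>Otherwise every \<open>(a, b, c)\<close> with \<open>c > 0\<close> has a P option. Only
  finitely many pairs of first two stacks occur in these options, and each admits at most one third
  stack, so only finitely many \<open>c\<close> can be served.\<close>

lemma P3_exists:
  assumes "0 < a" "0 < b"
  shows "\<exists>c. P3 a b c"
proof (rule ccontr)
  assume no: "\<nexists>c. P3 a b c"
  define F where "F p q = {c. P3 p q c}" for p q
  have fin: "finite (F p q)" for p q
  proof (rule finite_subset)
    show "F p q \<subseteq> {THE c. P3 p q c}"
      unfolding F_def using P3_unique by (auto intro!: the_equality[symmetric])
  qed simp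
  define S where "S = (\<Union>i\<in>{..a}. F (a - i) b) \<union> (\<Union>i\<in>{..a}. F (a - i) (b - i))
    \<union> (\<Union>i\<in>{..b}. (+) i ` F a (b - i))"
  have "c \<in> S" if "0 < c" for c
  proof -
    have "\<not> P3 a b c" using no by blast
    then show ?thesis using assms that
    proof (cases rule: P3_option_cases)
      case (right_pair i)
      then have "c \<in> (+) i ` F a (b - i)"
        unfolding F_def by (intro image_eqI[of _ _ "c - i"]) auto
      then show ?thesis unfolding S_def using right_pair by auto
    qed (use no in \<open>auto simp: S_def F_def\<close>)
  qed
  then have "{0<..} \<subseteq> S" by auto
  moreover have "finite S" unfolding S_def using fin by auto
  ultimately show False using infinite_Ioi finite_subset by blast
qed

section \<open>Wythoff pairs\<close>

lemma phi_square: "phi\<^sup>2 = phi + 1"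
  by (simp add: phi_def power2_eq_square field_simps)

lemma phi_mult_phi: "phi * (phi * x) = phi * x + x"
proof -
  have "phi * (phi * x) = phi\<^sup>2 * x" by (simp add: power2_eq_square)
  then show ?thesis by (simp add: phi_square algebra_simps)
qed

lemma phi_gt_1: "1 < phi" and phi_less_2: "phi < 2"
proof -
  have "1 < sqrt 5" "sqrt 5 < 3" by (auto simp: real_less_rsqrt real_less_lsqrt)
  then show "1 < phi" "phi < 2" by (auto simp: phi_def)
qed

lemma le_phi_mult: "0 \<le> r \<Longrightarrow> r \<le> phi * r"
  using phi_gt_1 mult_right_mono[of 1 phi r] by simp

text \<open>Descent behind the irrationality of \<open>phi\<close>: cutting off a square,
  \<open>k = n + r\<close>, gives the same equation for \<open>n\<close> and \<open>r\<close> with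
  \<open>0 < r < n\<close>.\<close>

lemma no_golden_rectangle: "k * k \<noteq> n * k + n * n" if "0 < n" for k n :: nat
  using that
proof (induction n arbitrary: k rule: less_induct)
  case (less n)
  show ?case
  proof
    assume eq: "k * k = n * k + n * n"
    have "n < k"
    proof (rule ccontr)
      assume "\<not> n < k"
      then have "k * k \<le> n * k" by simp
      then show False using eq less.prems by simp
    qed
    define r where "r = k - n"
    have r: "k = n + r" "0 < r" using \<open>n < k\<close> by (auto simp: r_def)
    have eq': "n * n = r * n + r * r" using eq unfolding r(1) by (simp add: algebra_simps)
    have "r < n"
    proof (rule ccontr)
      assume "\<not> r < n"
      then have "n * n \<le> r * n" by simp
      then show False using eq' r by simp
    qed
    then show False using less.IH[of r n] r eq' by blast
  qed
qed

lemma phi_multiple_not_nat: "0 < n \<Longrightarrow> real n * phi \<noteq> real k"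
proof
  assume "0 < n" and eq: "real n * phi = real k"
  have "real k * real k = real n * real n * phi\<^sup>2"
    unfolding eq[symmetric] by (simp add: power2_eq_square)
  also have "\<dots> = real n * real k + real n * real n"
    unfolding phi_square eq[symmetric] by (simp add: algebra_simps)
  finally have "real (k * k) = real (n * k + n * n)" by simp
  then show False using no_golden_rectangle[OF \<open>0 < n\<close>] by (simp only: of_nat_eq_iff)
qed

text \<open>The lower Wythoff sequence 1, 3, 4, 6, ... from \<open>n = 1\<close> on. As
  \<open>phi\<^sup>2 = phi + 1\<close>, the upper sequence is \<open>wythoff n + n\<close>.\<close>

definition wythoff :: "nat \<Rightarrow> nat" where
  "wythoff n = nat \<lfloor>real n * phi\<rfloor>"

lemma wythoff_eqI: "real k \<le> real n * phi \<Longrightarrow> real n * phi < real k + 1 \<Longrightarrow> wythoff n = k"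
  by (simp add: wythoff_def floor_eq_iff nat_eq_iff)

lemma wythoff_bounds: "real (wythoff n) \<le> real n * phi" "real n * phi < real (wythoff n) + 1"
proof -
  have "0 \<le> real n * phi" using phi_gt_1 by simp
  then have "real (wythoff n) = of_int \<lfloor>real n * phi\<rfloor>" by (simp add: wythoff_def)
  then show "real (wythoff n) \<le> real n * phi" "real n * phi < real (wythoff n) + 1"
    by linarith+
qed

lemma wythoff_bound_strict: "0 < n \<Longrightarrow> real (wythoff n) < real n * phi"
  using wythoff_bounds(1)[of n] phi_multiple_not_nat[of n "wythoff n"] by simp

lemma wythoff_0: "wythoff 0 = 0"
  by (simp add: wythoff_def)

lemma wythoff_strict_mono: "strict_mono wythoff"
proof (rule strict_mono_Suc_iff[THEN iffD2], rule allI)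
  fix n
  have "real (Suc n) * phi = real n * phi + phi" by (simp add: algebra_simps)
  then have "real (wythoff n) + 1 < real (wythoff (Suc n)) + 1"
    using wythoff_bounds(1)[of n] wythoff_bounds(2)[of "Suc n"] phi_gt_1 by linarith
  then show "wythoff n < wythoff (Suc n)" by simp
qed

lemma wythoff_less_iff: "wythoff m < wythoff n \<longleftrightarrow> m < n"
  using wythoff_strict_mono by (rule strict_mono_less)

lemma wythoff_eq_iff: "wythoff m = wythoff n \<longleftrightarrow> m = n"
  using wythoff_strict_mono by (rule strict_mono_eq)

text \<open>\<open>phi - 1\<close> is the reciprocal of \<open>phi\<close>, so multiplying the bound
  on \<open>n * phi\<close> by it isolates \<open>n\<close>. Together with
  \<open>wythoff_sum_lower\<close> this yields the exact floor and ceiling for sharpness.\<close>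

lemma wythoff_sum_upper: "real (wythoff n + n) + 1 < phi * (real (wythoff n) + 1)"
proof -
  have "real n = real n * phi * (phi - 1)" by (simp add: phi_mult_phi algebra_simps)
  also have "\<dots> < (real (wythoff n) + 1) * (phi - 1)"
    using wythoff_bounds(2)[of n] phi_gt_1 by (intro mult_strict_right_mono) auto
  finally show ?thesis by (simp add: algebra_simps)
qed

lemma wythoff_sum_lower: "phi * real (wythoff n) \<le> real (wythoff n + n)"
proof -
  have "real (wythoff n) * (phi - 1) \<le> real n * phi * (phi - 1)"
    using wythoff_bounds(1)[of n] phi_gt_1 by (intro mult_right_mono) auto
  also have "\<dots> = real n" by (simp add: phi_mult_phi algebra_simps)
  finally show ?thesis by (simp add: algebra_simps)
qed

text \<open>Beatty's argument: for a common value \<open>k\<close>, scaling the bounds on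
  \<open>n * phi\<close> by \<open>phi\<close> and adding those on \<open>m * phi\<^sup>2\<close>
  puts \<open>n + m\<close> strictly between \<open>k\<close> and \<open>k + 1\<close>.
  Irrationality gives the strict lower bound.\<close>

lemma wythoff_disjoint:
  assumes "wythoff n = wythoff m + m"
  shows "m = 0"
proof (rule ccontr)
  assume "m \<noteq> 0"
  have "n \<noteq> 0"
  proof
    assume "n = 0"
    then show False using assms \<open>m \<noteq> 0\<close> by (simp add: wythoff_0)
  qed
  define k where "k = wythoff n"
  have n: "real k < real n * phi" "real n * phi < real k + 1"
    using wythoff_bound_strict[of n] wythoff_bounds[of n] \<open>n \<noteq> 0\<close> by (auto simp: k_def)
  have m: "real k \<le> real m * phi + real m" "real m * phi + real m < real k + 1"
    using wythoff_bounds[of m] assms by (auto simp: k_def)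
  have "phi * real k < phi * (phi * real n)" "phi * (phi * real n) < phi * (real k + 1)"
    using n phi_gt_1 by (simp_all add: mult.commute)
  then have "real k * (phi + 1) < real (n + m) * (phi + 1)"
    "real (n + m) * (phi + 1) < real (k + 1) * (phi + 1)"
    unfolding phi_mult_phi using m by (simp_all add: algebra_simps)
  then have "k < n + m" "n + m < k + 1"
    using phi_gt_1 by (simp_all only: mult_less_cancel_right of_nat_less_iff)
  then show False by simp
qed

text \<open>If \<open>n\<close> is least with \<open>k \<le> n * phi\<close> and \<open>k\<close> is not \<open>wythoff n\<close>, then
  \<open>k = wythoff m + m\<close> for \<open>m = k + 1 - n\<close>.\<close>

lemma wythoff_cover:
  assumes "0 < k"
  obtains n where "k = wythoff n" | n where "k = wythoff n + n"
proof -
  define n where "n = nat \<lceil>real k / phi\<rceil>"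
  have "0 < real k / phi" using assms phi_gt_1 by simp
  then have n: "real k / phi \<le> real n" "real n < real k / phi + 1" "1 \<le> n"
    by (auto simp: n_def) linarith+
  have lo: "real k \<le> real n * phi" and hi: "(real n - 1) * phi < real k"
    using n phi_gt_1 by (auto simp: field_simps)
  show ?thesis
  proof (cases "real n * phi < real k + 1")
    case True
    then show ?thesis using that(1)[of n] wythoff_eqI[OF lo] by simp
  next
    case False
    then have gt: "real k + 1 < real n * phi"
      using phi_multiple_not_nat[of n "k + 1"] n(3) by auto
    have "real n - 1 \<le> (real n - 1) * phi"
      using le_phi_mult[of "real n - 1"] n(3) by (simp add: mult.commute)
    then have "real n - 1 < real k" using hi by linarith
    then have nk: "n \<le> k" by linarith
    define m where "m = k + 1 - n"
    have rm: "real m = real k + 1 - real n" "real (n - 1) = real n - 1"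
      using nk n(3) by (auto simp: m_def of_nat_diff)
    \<comment> \<open>Scaled by \<open>phi\<close>, the bounds around \<open>k\<close> turn into
      \<open>n - 1 \<le> m * phi < n\<close>.\<close>
    have "phi * (real k + 1) < phi * (phi * real n)" "phi * ((real n - 1) * phi) \<le> phi * real k"
      using gt hi phi_gt_1 by (simp_all add: mult.commute)
    then have 1: "real m * phi < real n" and 2: "real n - 1 \<le> real m * phi"
      using phi_square by (simp_all add: rm power2_eq_square phi_mult_phi algebra_simps)
    have "wythoff m = n - 1" using 1 2 rm(2) by (intro wythoff_eqI) linarith+
    then have "k = wythoff m + m" using nk n(3) by (simp add: m_def)
    then show ?thesis using that(2) by blast
  qed
qed

section \<open>Wythoff pairs as the P positions with two stacks\<close>

definition wythoff_pair :: "nat \<Rightarrow> nat \<Rightarrow> bool" where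
  "wythoff_pair x y \<longleftrightarrow> (\<exists>n. x = wythoff n \<and> y = wythoff n + n \<or> y = wythoff n \<and> x = wythoff n + n)"

lemma wythoff_pair_sym: "wythoff_pair x y \<longleftrightarrow> wythoff_pair y x"
  by (auto simp: wythoff_pair_def)

lemma wythoff_pair_0: "wythoff_pair 0 y \<longleftrightarrow> y = 0"
proof -
  have "n = 0" if "wythoff n = 0" for n using that wythoff_eq_iff[of n 0] by (simp add: wythoff_0)
  then show ?thesis by (auto simp: wythoff_pair_def wythoff_0 intro!: exI[of _ 0])
qed

lemma wythoff_pair_unique:
  assumes "wythoff_pair x y" "wythoff_pair x y'"
  shows "y = y'"
proof -
  have sum_inj: "m = n" if "wythoff m + m = wythoff n + n" for m n
    using that wythoff_less_iff[of m n] wythoff_less_iff[of n m] by linarith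
  show ?thesis
    using assms unfolding wythoff_pair_def
    by (metis wythoff_disjoint sum_inj wythoff_eq_iff add.right_neutral)
qed

text \<open>A common shift preserves the difference of the entries, which is the index
  \<open>n\<close>.\<close>

lemma wythoff_pair_not_diagonal:
  assumes "wythoff_pair x y" "0 < m"
  shows "\<not> wythoff_pair (x + m) (y + m)"
proof
  assume "wythoff_pair (x + m) (y + m)"
  then obtain n n' where "x = wythoff n \<and> y = wythoff n + n \<or> y = wythoff n \<and> x = wythoff n + n"
    "x + m = wythoff n' \<and> y + m = wythoff n' + n' \<or> y + m = wythoff n' \<and> x + m = wythoff n' + n'"
    using assms(1) unfolding wythoff_pair_def by blast
  then have "n = n'" using assms(2) by auto
  then show False using \<open>x = _ \<and> _ \<or> _\<close> \<open>x + m = _ \<and> _ \<or> _\<close> assms(2) by auto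
qed

text \<open>For \<open>x = wythoff n\<close>, a too large \<open>y\<close> is cut down to its
  partner; a too small one has difference \<open>m < n\<close>, and the diagonal leads to the pair
  of index \<open>m\<close>. For \<open>x = wythoff n + n\<close>, \<open>y\<close> is cut down to
  \<open>wythoff n\<close>.\<close>

lemma wythoff_pair_reachable:
  assumes "\<not> wythoff_pair x y" "0 < x" "x \<le> y"
  shows "(\<exists>k. 1 \<le> k \<and> k \<le> y \<and> wythoff_pair x (y - k)) \<or>
    (\<exists>k. 1 \<le> k \<and> k \<le> x \<and> wythoff_pair (x - k) (y - k))"
proof (cases rule: wythoff_cover[OF assms(2)])
  case (1 n)
  consider "y < wythoff n + n" | "wythoff n + n < y" | "y = wythoff n + n" by linarith
  then show ?thesis
  proof cases
    case lt: 1
    define m where "m = y - x"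
    have "m < n" using lt 1 assms by (auto simp: m_def)
    then have "wythoff m < x" using 1 wythoff_less_iff by simp
    then have "wythoff_pair (x - (x - wythoff m)) (y - (x - wythoff m))"
      unfolding wythoff_pair_def using assms(3) by (intro exI[of _ m]) (auto simp: m_def)
    then show ?thesis using \<open>wythoff m < x\<close>
      by (intro disjI2 exI[of _ "x - wythoff m"]) auto
  next
    case 2
    then show ?thesis
      by (intro disjI1 exI[of _ "y - (wythoff n + n)"]) (auto simp: wythoff_pair_def 1)
  next
    case 3
    then show ?thesis using assms(1) 1 by (auto simp: wythoff_pair_def)
  qed
next
  case (2 n)
  have "n \<noteq> 0" using assms(2) 2 wythoff_0 by (metis add_cancel_right_right less_numeral_extra(3))
  then have "wythoff n < y" using assms(3) 2 by simp
  then show ?thesis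
    using 2 by (intro disjI1 exI[of _ "y - wythoff n"]) (auto simp: wythoff_pair_def)
qed

lemma P2_iff_wythoff_pair: "P2 x y \<longleftrightarrow> wythoff_pair x y"
proof (induction "x + y" arbitrary: x y rule: less_induct)
  case less
  show ?case
  proof (cases "x = 0 \<or> y = 0")
    case True
    then show ?thesis
      using wythoff_pair_0[of x] wythoff_pair_0[of y] wythoff_pair_sym[of x y]
      by (auto simp: P2_zero_left P2_zero_right)
  next
    case False
    then have pos: "0 < x" "0 < y" by auto
    have IH: "1 \<le> k \<and> k \<le> x \<Longrightarrow> P2 (x - k) y \<longleftrightarrow> wythoff_pair (x - k) y"
      "1 \<le> k \<and> k \<le> y \<Longrightarrow> P2 x (y - k) \<longleftrightarrow> wythoff_pair x (y - k)"
      "1 \<le> k \<and> k \<le> x \<and> k \<le> y \<Longrightarrow> P2 (x - k) (y - k) \<longleftrightarrow> wythoff_pair (x - k) (y - k)" for k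
      by (intro less; simp)+
    have "P2 x y \<longleftrightarrow>
      (\<forall>k. 1 \<le> k \<and> k \<le> x \<longrightarrow> \<not> wythoff_pair (x - k) y) \<and>
      (\<forall>k. 1 \<le> k \<and> k \<le> y \<longrightarrow> \<not> wythoff_pair x (y - k)) \<and>
      (\<forall>k. 1 \<le> k \<and> k \<le> x \<and> k \<le> y \<longrightarrow> \<not> wythoff_pair (x - k) (y - k))" (is "_ \<longleftrightarrow> ?R")
      unfolding P2_iff[OF pos] using IH by blast
    also have "?R \<longleftrightarrow> wythoff_pair x y"
    proof
      assume ?R
      show "wythoff_pair x y"
      proof (rule ccontr)
        assume no: "\<not> wythoff_pair x y"
        show False
        proof (cases "x \<le> y")
          case True
          then show ?thesis using wythoff_pair_reachable[OF no pos(1)] \<open>?R\<close> le_trans by blast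
        next
          case False
          then show ?thesis
            using wythoff_pair_reachable[of y x] no pos \<open>?R\<close> wythoff_pair_sym
            by (meson le_trans nat_le_linear)
        qed
      qed
    next
      assume w: "wythoff_pair x y"
      have "\<not> wythoff_pair x (y - k)" if "1 \<le> k \<and> k \<le> y" for k
        using wythoff_pair_unique[OF w, of "y - k"] that by auto
      moreover have "\<not> wythoff_pair (x - k) y" if "1 \<le> k \<and> k \<le> x" for k
        using wythoff_pair_unique[of y x "x - k"] w wythoff_pair_sym that by auto
      moreover have "\<not> wythoff_pair (x - k) (y - k)" if "1 \<le> k \<and> k \<le> x \<and> k \<le> y" for k
        using wythoff_pair_not_diagonal[of "x - k" "y - k" k] w that by auto
      ultimately show ?R by blast
    qed
    finally show ?thesis .
  qed
qed

text \<open>Estimate for the starts of chains. Either entry may be the larger, since lower and upper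
  chains start differently.\<close>

lemma P2_bound:
  assumes "P2 x y"
  shows "real y < phi * real x + 1"
proof -
  have *: "real (wythoff n + n) < phi * real (wythoff n) + 1" for n
    using wythoff_sum_upper[of n] phi_less_2 by (simp add: algebra_simps)
  have "real (wythoff n) < phi * real (wythoff n + n) + 1" for n
  proof -
    have "real (wythoff n) \<le> real (wythoff n + n)" by simp
    also have "\<dots> \<le> phi * real (wythoff n + n)"
      by (rule le_phi_mult) simp
    finally show ?thesis by simp
  qed
  then show ?thesis
    using assms * unfolding P2_iff_wythoff_pair wythoff_pair_def by blast
qed

section \<open>Bounds for the middle stack\<close>

text \<open>Induction along chains: passing to the predecessor subtracts the same \<open>k\<close>
  from both coordinates, and \<open>k \<le> phi\<^sup>2 * k\<close> absorbs it. The strict bound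
  with \<open>+ 1\<close> encodes the ceiling.\<close>

lemma middle_upper_bound:
  assumes "P3 a b c" "a \<noteq> c" "0 < a"
  shows "real b < phi\<^sup>2 * real a + 1"
  using assms
proof (induction a arbitrary: b c rule: less_induct)
  case (less a)
  have b: "0 < b" using less.prems by (cases "b = 0") (auto simp: P3_zero_middle)
  show ?case
  proof (cases "a < c")
    case True
    then obtain k where k: "1 \<le> k" "k \<le> a" "k < b" "P3 (a - k) (b - k) a"
      using lower_predecessor[OF less.prems(1)] less.prems b by auto
    show ?thesis
    proof (cases "k = a")
      case True
      then have "P2 a (b - a)" using k P2_sym by (simp add: P3_zero_left)
      then show ?thesis using P2_bound[of a "b - a"] k True
        by (simp add: phi_square algebra_simps of_nat_diff)
    next
      case False
      then have "real (b - k) < phi\<^sup>2 * real (a - k) + 1"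
        using less.IH[of "a - k" "b - k" a] k by auto
      moreover have "real k \<le> phi * real k + real k" using phi_gt_1 by simp
      ultimately show ?thesis using k by (simp add: phi_square algebra_simps of_nat_diff)
    qed
  next
    case False
    then have c: "c < a" using less.prems by simp
    show ?thesis
    proof (cases "c = 0")
      case True
      then have "P2 a b" using less.prems by (simp add: P3_zero_right)
      then show ?thesis using P2_bound[of a b] by (simp add: phi_square algebra_simps)
    next
      case False
      have cba: "P3 c b a" using less.prems P3_sym by blast
      then have "a < c + b" using P3_triangle False b by simp
      then obtain a' where a': "a' < c" "P3 a' (c + b - a) c"
        using upper_predecessor[OF cba] False c by auto
      then have "real (c + b - a) < phi\<^sup>2 * real c + 1"
        using less.IH[of c "c + b - a" a'] P3_sym c False by auto
      then have "real b < phi * real c + real a + 1" using \<open>a < c + b\<close>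
        by (simp add: phi_square algebra_simps of_nat_diff)
      moreover have "phi * real c \<le> phi * real a" using c phi_gt_1 by simp
      ultimately show ?thesis by (simp add: phi_square algebra_simps)
    qed
  qed
qed

text \<open>The same induction, with \<open>k \<le> phi * k\<close> absorbing the shift. This is the
  floor bound cleared of division.\<close>

lemma middle_lower_bound:
  assumes "P3 a b c" "a \<noteq> c" "0 < a"
  shows "real a < phi * (real b + 1)"
  using assms
proof (induction a arbitrary: b c rule: less_induct)
  case (less a)
  have b: "0 < b" using less.prems by (cases "b = 0") (auto simp: P3_zero_middle)
  show ?case
  proof (cases "a < c")
    case True
    then obtain k where k: "1 \<le> k" "k \<le> a" "k < b" "P3 (a - k) (b - k) a"
      using lower_predecessor[OF less.prems(1)] less.prems b by auto
    show ?thesis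
    proof (cases "k = a")
      case True
      then have "real a < real b + 1" using k by simp
      then show ?thesis using le_phi_mult[of "real b + 1"] by linarith
    next
      case False
      then have "real (a - k) < phi * (real (b - k) + 1)"
        using less.IH[of "a - k" "b - k" a] k by auto
      then have "real a - real k < phi * (real b + 1) - phi * real k"
        using k by (simp add: algebra_simps of_nat_diff)
      then show ?thesis using le_phi_mult[of "real k"] by linarith
    qed
  next
    case False
    then have c: "c < a" using less.prems by simp
    have cba: "P3 c b a" using less.prems P3_sym by blast
    show ?thesis
    proof (cases "c = 0")
      case True
      then have "P2 b a" using cba by (simp add: P3_zero_left)
      then show ?thesis using P2_bound[of b a] phi_gt_1 by (simp add: algebra_simps)
    next
      case False
      have "a < c + b" using P3_triangle cba False b by simp
      then obtain a' where a': "a' < c" "P3 a' (c + b - a) c"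
        using upper_predecessor[OF cba] False c by auto
      then have "real c < phi * (real (c + b - a) + 1)"
        using less.IH[of c "c + b - a" a'] P3_sym c False by auto
      then have "real c < phi * (real b + 1) - phi * real (a - c)"
        using \<open>a < c + b\<close> c by (simp add: algebra_simps of_nat_diff)
      then show ?thesis using c le_phi_mult[of "real (a - c)"] by linarith
    qed
  qed
qed

section \<open>Both bounds and their sharpness\<close>

theorem theorem10:
  shows "(\<forall>a b c :: nat. P_position [a, b, c] \<and> a \<noteq> c \<longrightarrow>
            a = 0 \<or> (\<lfloor>real a / phi\<rfloor> \<le> int b \<and> int b \<le> \<lceil>phi\<^sup>2 * real a\<rceil>))
       \<and> infinite {(a, b, c). P_position [a, b, c] \<and> a \<noteq> c \<and> a > 0 \<and> \<lfloor>real a / phi\<rfloor> = int b}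
       \<and> infinite {(a, b, c). P_position [a, b, c] \<and> a \<noteq> c \<and> a > 0 \<and> int b = \<lceil>phi\<^sup>2 * real a\<rceil>}"
    (is "?bounds \<and> infinite ?L \<and> infinite ?U")
proof (intro conjI)
  show ?bounds
  proof (intro allI impI)
    fix a b c :: nat
    assume *: "P3 a b c \<and> a \<noteq> c"
    have "\<lfloor>real a / phi\<rfloor> \<le> int b \<and> int b \<le> \<lceil>phi\<^sup>2 * real a\<rceil>" if "0 < a"
      using middle_lower_bound[of a b c] middle_upper_bound[of a b c] * that phi_gt_1
      by (simp add: floor_le_iff le_ceiling_iff field_simps)
    then show "a = 0 \<or> (\<lfloor>real a / phi\<rfloor> \<le> int b \<and> int b \<le> \<lceil>phi\<^sup>2 * real a\<rceil>)" by auto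
  qed
  have pos: "0 < wythoff n" if "0 < n" for n
    using wythoff_less_iff[of 0 n] that by (simp add: wythoff_0)
  show "infinite ?L"
  proof (rule infinite_super)
    show "(\<lambda>n. (wythoff n + n, wythoff n, 0 :: nat)) ` {0<..} \<subseteq> ?L"
    proof
      fix p assume "p \<in> (\<lambda>n. (wythoff n + n, wythoff n, 0 :: nat)) ` {0<..}"
      then obtain n where n: "p = (wythoff n + n, wythoff n, 0)" "0 < n" by auto
      have "P2 (wythoff n + n) (wythoff n)"
        unfolding P2_iff_wythoff_pair wythoff_pair_def by blast
      then have "P3 (wythoff n + n) (wythoff n) 0" by (simp add: P3_zero_right)
      moreover have "\<lfloor>real (wythoff n + n) / phi\<rfloor> = int (wythoff n)"
        using wythoff_sum_lower[of n] wythoff_sum_upper[of n] phi_gt_1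
        by (simp add: floor_eq_iff field_simps)
      ultimately show "p \<in> ?L" using n by simp
    qed
    show "infinite ((\<lambda>n. (wythoff n + n, wythoff n, 0 :: nat)) ` {0<..})"
      by (subst finite_image_iff) (auto simp: inj_on_def wythoff_eq_iff infinite_Ioi)
  qed
  show "infinite ?U"
  proof -
    have "\<exists>c. (wythoff n, wythoff n + (wythoff n + n), c) \<in> ?U" if n: "0 < n" for n
    proof -
      \<comment> \<open>Adding \<open>?a\<close> to the last two stacks of the P position
        \<open>(?a, wythoff n + n, 0)\<close> gives \<open>(?a, ?b, ?a)\<close>, which is therefore
        N; the P position over \<open>?a\<close> and \<open>?b\<close> is no palindrome.\<close>
      let ?a = "wythoff n" and ?b = "wythoff n + (wythoff n + n)"
      obtain c where c: "P3 ?a ?b c" using P3_exists[of ?a ?b] pos[OF n] by auto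
      have "P3 0 (wythoff n + n) ?a"
        unfolding P3_zero_left P2_iff_wythoff_pair wythoff_pair_def by blast
      then have "P3 ?a (wythoff n + n) 0" using P3_sym by blast
      then have "\<not> P3 ?a ?b ?a"
        using P3_not_diagonal[of ?a "wythoff n + n" 0 ?a] pos[OF n] by (simp add: add.commute)
      then have "?a \<noteq> c" using c by metis
      moreover have "int ?b = \<lceil>phi\<^sup>2 * real ?a\<rceil>"
        using wythoff_sum_lower[of n] wythoff_sum_upper[of n] phi_less_2
        by (intro ceiling_unique[symmetric]) (simp_all add: phi_square algebra_simps)
      ultimately show ?thesis using c pos[OF n] by blast
    qed
    then have "wythoff n \<in> fst ` ?U" if "0 < n" for n
      using that by (metis (no_types, lifting) fst_conv imageI)
    \<comment> \<open>The third stack is not explicit, so infinitude is read off from the first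
      stacks.\<close>
    then have sub: "wythoff ` {0<..} \<subseteq> fst ` ?U" by blast
    have "infinite (wythoff ` {0<..})"
      by (subst finite_image_iff) (auto simp: inj_on_def wythoff_eq_iff infinite_Ioi)
    then show ?thesis using finite_subset[OF sub] finite_imageI[of ?U fst] by blast
  qed
qed

end
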